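(* For $n\ge2$ let $Q_n(\beta)$ be the specialization $x_{ij}=1$ (for all $i,j$) of the reduced polynomial of the element $w_0^{(n)}=\prod_{1\le i<j\le n}x_{ij}$. Then $$Q_n(\beta-1)=\left(\sum_{m\ge0}\iota(\mathcal{CRY}_{n+1},m)\,\beta^m\right)(1-\beta)^{\binom{n+1}{2}+1},$$ where $\mathcal{CRY}_N$ denotes the Chan–Robbins–Yuen polytope, i.e. the convex polytope of $N\times N$ matrices $(a_{ij})$ with non-negative entries such that (1) $\sum_ia_{ij}=1$ for all $j$ and $\sum_ja_{ij}=1$ for all $i$; (2) $a_{ij}=0$ if $j>i+1$. Here, for an integral convex polytope $\mathcal{P}\subset\mathbb{R}^d$, $\iota(\mathcal{P},m)$ is the number of integer points in $m\mathcal{P}$.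
   Context: Reduced polynomial: work in the commutative polynomial ring in variables $x_{ij}$, $1\le i<j\le n$, over $\mathbb{Z}[\beta]$, and, starting from $\prod_{i<j}x_{ij}$, repeatedly replace (in any monomial) a product $x_{ij}x_{jk}$ with $i<j<k$ by $x_{ik}x_{ij}+x_{jk}x_{ik}+\beta x_{ik}$, in any order, until no monomial contains such a product. The resulting polynomial $Q_n(x_{ij};\beta)$ may depend on the order of the replacements; $Q_n(\beta)$ is its value at $x_{ij}=1$ for all $i<j$ (this value does not depend on the order). *)

theory Defs
  imports
    "HOL-Library.Poly_Mapping"
    "HOL-Computational_Algebra.Computational_Algebra"
    "Jordan_Normal_Form.Matrix"
begin

text \<open>
  Polynomials in the commuting variables \<open>x\<^sub>i\<^sub>j\<close>, indexed by pairs \<open>(i, j)\<close>, with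
  coefficients in \<open>\<int>[\<beta>]\<close>. The coefficient ring is \<^typ>\<open>int poly\<close>, with
  \<open>[:0, 1:]\<close> in the role of \<open>\<beta>\<close>.
\<close>

type_synonym xmonom = "(nat \<times> nat) \<Rightarrow>\<^sub>0 nat"
type_synonym xpoly = "xmonom \<Rightarrow>\<^sub>0 int poly"

definition xvar :: "nat \<Rightarrow> nat \<Rightarrow> xmonom" where
  "xvar i j = Poly_Mapping.single (i, j) 1"

definition X :: "nat \<Rightarrow> nat \<Rightarrow> xpoly" where
  "X i j = Poly_Mapping.single (xvar i j) 1"

definition Beta :: xpoly where
  "Beta = Poly_Mapping.single 0 [:0, 1:]"

definition pairs :: "nat \<Rightarrow> (nat \<times> nat) set" where
  "pairs n = {(i, j). 1 \<le> i \<and> i < j \<and> j \<le> n}"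

definition w0 :: "nat \<Rightarrow> xpoly" where
  "w0 n = (\<Prod>(i, j)\<in>pairs n. X i j)"

text \<open>
  One replacement: a monomial \<open>m \<cdot> x\<^sub>i\<^sub>j \<cdot> x\<^sub>j\<^sub>k\<close> that occurs in \<open>P\<close> is rewritten,
  together with its whole coefficient \<open>c\<close>.
\<close>

definition reduction_step :: "xpoly \<Rightarrow> xpoly \<Rightarrow> bool" where
  "reduction_step P Q \<longleftrightarrow>
     (\<exists>i j k m. i < j \<and> j < k \<and> m + xvar i j + xvar j k \<in> Poly_Mapping.keys P \<and>
        (let c = Poly_Mapping.lookup P (m + xvar i j + xvar j k) in
           Q = P - Poly_Mapping.single (m + xvar i j + xvar j k) c
                 + Poly_Mapping.single m c * (X i k * X i j + X j k * X i k + Beta * X i k)))"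

definition is_reduced :: "xpoly \<Rightarrow> bool" where
  "is_reduced P \<longleftrightarrow>
     \<not> (\<exists>i j k m. i < j \<and> j < k \<and> m + xvar i j + xvar j k \<in> Poly_Mapping.keys P)"

definition reduced_polynomial_of :: "xpoly \<Rightarrow> xpoly \<Rightarrow> bool" where
  "reduced_polynomial_of P Q \<longleftrightarrow> reduction_step\<^sup>*\<^sup>* P Q \<and> is_reduced Q"

definition eval_xpoly :: "(nat \<times> nat \<Rightarrow> int poly) \<Rightarrow> xpoly \<Rightarrow> int poly" where
  "eval_xpoly v P = (\<Sum>m\<in>Poly_Mapping.keys P.
     Poly_Mapping.lookup P m * (\<Prod>z\<in>Poly_Mapping.keys m. v z ^ Poly_Mapping.lookup m z))"

text \<open>
  Rows and columns of \<^typ>\<open>real mat\<close> are numbered from 0; the condition \<open>j > i + 1\<close>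
  is unaffected by this shift.
\<close>

definition CRY :: "nat \<Rightarrow> real mat set" where
  "CRY N = {A \<in> carrier_mat N N.
     (\<forall>i<N. \<forall>j<N. 0 \<le> A $$ (i, j)) \<and>
     (\<forall>j<N. (\<Sum>i<N. A $$ (i, j)) = 1) \<and>
     (\<forall>i<N. (\<Sum>j<N. A $$ (i, j)) = 1) \<and>
     (\<forall>i<N. \<forall>j<N. j > i + 1 \<longrightarrow> A $$ (i, j) = 0)}"

definition ehrhart :: "real mat set \<Rightarrow> nat \<Rightarrow> nat" where
  "ehrhart \<P> m = card {B \<in> (\<lambda>A. real m \<cdot>\<^sub>m A) ` \<P>. elements_mat B \<subseteq> \<int>}"

text \<open>
  The replacement procedure stops, so every \<^term>\<open>w0 n\<close> has a reduced polynomial: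
  each replacement exchanges a monomial for three of smaller weight, where \<open>x\<^sub>i\<^sub>j\<close>
  has weight \<open>n - (j - i)\<close>.
\<close>

definition weight :: "nat \<Rightarrow> xmonom \<Rightarrow> nat" where
  "weight n m = (\<Sum>z\<in>pairs n. Poly_Mapping.lookup m z * (n - (snd z - fst z)))"

definition total_weight :: "nat \<Rightarrow> xpoly \<Rightarrow> nat" where
  "total_weight n P = (\<Sum>m\<in>Poly_Mapping.keys P. 4 ^ weight n m)"

definition vars_in :: "nat \<Rightarrow> xpoly \<Rightarrow> bool" where
  "vars_in n P \<longleftrightarrow> (\<forall>m\<in>Poly_Mapping.keys P. Poly_Mapping.keys m \<subseteq> pairs n)"

lemma finite_pairs: "finite (pairs n)"
  by (rule finite_subset[of _ "{..n} \<times> {..n}"]) (auto simp: pairs_def)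

lemma weight_add: "weight n (a + b) = weight n a + weight n b"
  by (simp add: weight_def lookup_add sum.distrib algebra_simps)

lemma weight_xvar: "(i, j) \<in> pairs n \<Longrightarrow> weight n (xvar i j) = n - (j - i)"
proof -
  assume *: "(i, j) \<in> pairs n"
  have "weight n (xvar i j) = (\<Sum>z\<in>pairs n. if z = (i, j) then n - (j - i) else 0)"
    unfolding weight_def xvar_def
    by (rule sum.cong) (auto simp: lookup_single when_def)
  then show ?thesis using * finite_pairs by simp
qed

lemma keys_add_nat: "Poly_Mapping.keys (a + b :: xmonom) = Poly_Mapping.keys a \<union> Poly_Mapping.keys b"
  by (auto simp: in_keys_iff lookup_add)

lemma keys_xvar: "Poly_Mapping.keys (xvar i j) = {(i, j)}"
  by (simp add: xvar_def)

lemma replacement_eq: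
  "Poly_Mapping.single m c * (X i k * X i j + X j k * X i k + Beta * X i k) =
     Poly_Mapping.single (m + xvar i k + xvar i j) c
   + Poly_Mapping.single (m + xvar j k + xvar i k) c
   + Poly_Mapping.single (m + xvar i k) (c * [:0, 1:])"
  by (simp add: X_def Beta_def mult_single distrib_left add.assoc)

lemma reduction_step_keys:
  assumes "reduction_step P Q"
  obtains i j k m where "i < j" "j < k" "m + xvar i j + xvar j k \<in> Poly_Mapping.keys P"
    "Poly_Mapping.keys Q \<subseteq> (Poly_Mapping.keys P - {m + xvar i j + xvar j k})
       \<union> {m + xvar i k + xvar i j, m + xvar j k + xvar i k, m + xvar i k}"
proof -
  from assms obtain i j k m where *: "i < j" "j < k"
      "m + xvar i j + xvar j k \<in> Poly_Mapping.keys P"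
    and Q: "Q = P - Poly_Mapping.single (m + xvar i j + xvar j k)
                      (Poly_Mapping.lookup P (m + xvar i j + xvar j k))
       + Poly_Mapping.single m (Poly_Mapping.lookup P (m + xvar i j + xvar j k))
         * (X i k * X i j + X j k * X i k + Beta * X i k)"
    by (auto simp: reduction_step_def Let_def)
  show thesis
    by (rule that[OF *])
      (auto simp: Q[unfolded replacement_eq] in_keys_iff lookup_add lookup_minus lookup_single when_def
          split: if_splits)
qed

lemma reduction_step_decreases:
  assumes "vars_in n P" "reduction_step P Q"
  shows "vars_in n Q \<and> total_weight n Q < total_weight n P"
proof -
  from reduction_step_keys[OF assms(2)] obtain i j k m where
    ij: "i < j" "j < k" and M: "m + xvar i j + xvar j k \<in> Poly_Mapping.keys P"
    and K: "Poly_Mapping.keys Q \<subseteq> (Poly_Mapping.keys P - {m + xvar i j + xvar j k})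
       \<union> {m + xvar i k + xvar i j, m + xvar j k + xvar i k, m + xvar i k}"
    by metis
  let ?M = "m + xvar i j + xvar j k"
  let ?N = "{m + xvar i k + xvar i j, m + xvar j k + xvar i k, m + xvar i k}"
  from assms(1) M have sub: "Poly_Mapping.keys ?M \<subseteq> pairs n"
    unfolding vars_in_def by blast
  then have mem: "(i, j) \<in> pairs n" "(j, k) \<in> pairs n" and m: "Poly_Mapping.keys m \<subseteq> pairs n"
    by (auto simp: keys_add_nat keys_xvar)
  then have mem': "(i, k) \<in> pairs n" by (auto simp: pairs_def)
  have vars: "vars_in n Q"
    unfolding vars_in_def
  proof
    fix y assume "y \<in> Poly_Mapping.keys Q"
    with K have "y \<in> Poly_Mapping.keys P \<or> y \<in> ?N" by blast
    then show "Poly_Mapping.keys y \<subseteq> pairs n"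
      using assms(1) m mem mem' by (auto simp: vars_in_def keys_add_nat keys_xvar)
  qed
  have lt: "weight n y < weight n ?M" if "y \<in> ?N" for y
    using that mem mem' ij by (auto simp: weight_add weight_xvar pairs_def)
  then obtain w where w: "weight n ?M = Suc w" by (cases "weight n ?M") auto
  have bound: "sum ((\<lambda>e. (4::nat) ^ e) \<circ> weight n) ?N \<le> 3 * 4 ^ w"
  proof -
    have "sum ((\<lambda>e. (4::nat) ^ e) \<circ> weight n) ?N \<le> of_nat (card ?N) * (4::nat) ^ w"
    proof (rule sum_bounded_above)
      fix y assume "y \<in> ?N"
      then show "((\<lambda>e. (4::nat) ^ e) \<circ> weight n) y \<le> (4 :: nat) ^ w"
        using lt[of y] w by (simp del: insert_iff)
    qed
    also have "\<dots> \<le> 3 * 4 ^ w"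
    proof -
      have "card ?N \<le> 3" by (auto simp: card_insert_if)
      then show ?thesis by simp
    qed
    finally show ?thesis .
  qed
  have "total_weight n Q \<le> sum ((\<lambda>e. (4::nat) ^ e) \<circ> weight n) ((Poly_Mapping.keys P - {?M}) \<union> ?N)"
    unfolding total_weight_def using K by (simp add: comp_def) (intro sum_mono2; simp)
  also have "\<dots> \<le> sum ((\<lambda>e. (4::nat) ^ e) \<circ> weight n) (Poly_Mapping.keys P - {?M}) + sum ((\<lambda>e. (4::nat) ^ e) \<circ> weight n) ?N"
    by (subst sum_Un_nat) auto
  also have "\<dots> < sum ((\<lambda>e. (4::nat) ^ e) \<circ> weight n) (Poly_Mapping.keys P - {?M}) + 4 ^ weight n ?M"
    using order.strict_trans1[OF bound, of "4 ^ weight n ?M"] w by simp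
  also have "\<dots> = total_weight n P"
    unfolding total_weight_def by (subst sum.remove[OF _ M]) (auto simp: comp_def)
  finally show ?thesis using vars by blast
qed

lemma reduced_polynomial_exists_aux:
  "vars_in n P \<Longrightarrow> \<exists>Q. reduced_polynomial_of P Q"
proof (induction "total_weight n P" arbitrary: P rule: less_induct)
  case less
  show ?case
  proof (cases "is_reduced P")
    case True
    then show ?thesis by (auto simp: reduced_polynomial_of_def)
  next
    case False
    then obtain R where R: "reduction_step P R"
      unfolding is_reduced_def reduction_step_def Let_def by blast
    with less.prems less.hyps obtain Q where "reduced_polynomial_of R Q"
      using reduction_step_decreases by blast
    with R show ?thesis
      unfolding reduced_polynomial_of_def by (blast intro: converse_rtranclp_into_rtranclp)
  qed
qed

lemma w0_eq: "w0 n = Poly_Mapping.single (\<Sum>(i, j)\<in>pairs n. xvar i j) 1"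
proof -
  have "(\<Prod>(i, j)\<in>A. X i j) = Poly_Mapping.single (\<Sum>(i, j)\<in>A. xvar i j) 1"
    if "finite A" for A
    using that by induction (auto simp: X_def mult_single)
  then show ?thesis using finite_pairs by (simp add: w0_def)
qed

lemma reduced_polynomial_exists: "\<exists>Q. reduced_polynomial_of (w0 n) Q"
proof (rule reduced_polynomial_exists_aux)
  have "Poly_Mapping.keys (\<Sum>(i, j)\<in>A. xvar i j) \<subseteq> A" if "finite A" for A
    using that by induction (auto simp: keys_add_nat keys_xvar)
  then show "vars_in n (w0 n)"
    using finite_pairs by (simp add: vars_in_def w0_eq)
qed

end

theory Submission
  imports Defs "HOL-Combinatorics.Permutations"
begin

text \<open>
  The replacement rule is an identity between numbers of integer flows. Read a monomial as an acyclic
  multigraph on the vertices \<open>1, \<dots>, n\<close>, with one edge from \<open>i\<close> to \<open>j\<close> for every factor \<open>x\<^sub>i\<^sub>j\<close>. A flow is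
  any assignment of natural numbers to the edges; the net flow of a vertex is its outflow minus its
  inflow, and the size of a flow is the sum of the positive parts of all net flows, that is, the least
  amount that has to be sent from outside into the graph. Only finitely many flows have a given size,
  so each multigraph \<open>G\<close> has a generating function \<open>F\<^sub>G(q)\<close> that counts its flows by size.

  If \<open>G\<close> has edges \<open>i \<rightarrow> j \<rightarrow> k\<close> that carry \<open>a\<close> and \<open>b\<close>, then \<open>min a b\<close> can be rerouted along a new
  edge \<open>i \<rightarrow> k\<close> without changing any net flow. What remains is on \<open>i \<rightarrow> j\<close> if \<open>a \<ge> b\<close>, on \<open>j \<rightarrow> k\<close> if
  \<open>a \<le> b\<close>, and nowhere if \<open>a = b\<close>. Inclusion-exclusion expresses \<open>F\<^sub>G\<close> by the generating functions of
  the three resulting graphs (\<open>flow_gf_reduction\<close>). With \<open>d\<close> the number of edges,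
  \<open>H\<^sub>G = (1 - q)\<^sup>d F\<^sub>G\<close> therefore satisfies \<open>H\<^sub>G = H\<^sub>1 + H\<^sub>2 + (q - 1) H\<^sub>3\<close>, which is the replacement
  rule at \<open>\<beta> = q - 1\<close>. Hence the linear extension of \<open>H\<close> to polynomials is invariant under
  replacements (\<open>flow_value_reduction_step\<close>). In the graph of a reduced monomial no edge ends where
  another begins, so the size of a flow is just the sum of its values and \<open>H\<^sub>G = 1\<close>
  (\<open>flow_gf_alternating\<close>). So the value of any reduced polynomial at \<open>x\<^sub>i\<^sub>j = 1\<close>, \<open>\<beta> = q - 1\<close> is \<open>H\<close>
  of the complete graph on \<open>1, \<dots>, n\<close>.

  On the other side, an integer point of the \<open>m\<close>-th dilate of the polytope is determined by its
  entries on and below the diagonal, because the row and column sums force the superdiagonal. The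
  entry \<open>(i, j)\<close> with \<open>j \<le> i\<close> is the flow on the edge \<open>j \<rightarrow> i + 1\<close> of the complete graph on
  \<open>0, \<dots>, n + 1\<close>, and the row and column conditions say that this is a flow of \<open>m\<close> units from the source
  \<open>0\<close> to the sink \<open>n + 1\<close> (\<open>hessenberg_arrays_bij_betw\<close>). Its restriction to the edges inside
  \<open>1, \<dots>, n\<close> is arbitrary. What is left to choose is how much goes straight from the source to the
  sink, and for each inner vertex how much goes from the source through that vertex to the sink, in
  excess of what the net flow requires: \<open>n + 1\<close> free natural numbers, which contribute
  \<open>(1 - q)\<^bsup>-(n+1)\<^esup>\<close> (\<open>balanced_arrays_gf\<close>).
\<close>

section \<open>Generating functions of weighted sets\<close>

text \<open>
  Finitely many elements of each weight, which makes the counts in \<open>gf\<close> below meaningful.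
\<close>
definition wfin :: "'a set \<Rightarrow> ('a \<Rightarrow> nat) \<Rightarrow> bool" where
  "wfin A w \<longleftrightarrow> (\<forall>t. finite {x \<in> A. w x = t})"

text \<open>
  The generating function that counts the elements of \<open>A\<close> by their weight \<open>w\<close>.
\<close>
definition gf :: "'a set \<Rightarrow> ('a \<Rightarrow> nat) \<Rightarrow> int fps" where
  "gf A w = Abs_fps (\<lambda>t. int (card {x \<in> A. w x = t}))"

lemma bij_betw_fibre:
  assumes "bij_betw h A B" "\<And>x. x \<in> A \<Longrightarrow> w' (h x) = w x"
  shows "bij_betw h {x \<in> A. w x = t} {y \<in> B. w' y = t}"
  using assms by (fastforce simp: bij_betw_def inj_on_def image_iff)

lemma gf_bij_betw:
  assumes "bij_betw h A B" "\<And>x. x \<in> A \<Longrightarrow> w' (h x) = w x"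
  shows "gf A w = gf B w'"
proof -
  have "card {x \<in> A. w x = t} = card {y \<in> B. w' y = t}" for t
    by (rule bij_betw_same_card[OF bij_betw_fibre]) (use assms in auto)
  then show ?thesis by (simp add: gf_def)
qed

lemma gf_Un_Int:
  assumes "wfin (A \<union> B) w"
  shows "gf (A \<union> B) w = gf A w + gf B w - gf (A \<inter> B) w"
proof (rule fps_ext)
  fix t
  let ?F = "\<lambda>S. {x \<in> S. w x = t}"
  have fin: "finite (?F (A \<union> B))" using assms by (simp add: wfin_def)
  have U: "?F (A \<union> B) = ?F A \<union> ?F B" and I: "?F (A \<inter> B) = ?F A \<inter> ?F B" by auto
  have "card (?F A) + card (?F B) = card (?F (A \<union> B)) + card (?F (A \<inter> B))"
    unfolding U I by (rule card_Un_Int) (use fin U in auto)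
  then show "fps_nth (gf (A \<union> B) w) t = fps_nth (gf A w + gf B w - gf (A \<inter> B) w) t"
    by (simp add: gf_def)
qed

lemma fibre_Times:
  fixes w :: "'a \<Rightarrow> nat" and w' :: "'b \<Rightarrow> nat"
  shows "{x \<in> A \<times> B. w (fst x) + w' (snd x) = t}
     = (\<Union>i\<in>{0..t}. {x \<in> A. w x = i} \<times> {y \<in> B. w' y = t - i})"
  by auto

lemma gf_Times:
  assumes "wfin A w" "wfin B w'"
  shows "gf (A \<times> B) (\<lambda>x. w (fst x) + w' (snd x)) = gf A w * gf B w'"
proof (rule fps_ext)
  fix t
  have "card {x \<in> A \<times> B. w (fst x) + w' (snd x) = t}
      = (\<Sum>i\<in>{0..t}. card ({x \<in> A. w x = i} \<times> {y \<in> B. w' y = t - i}))"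
    unfolding fibre_Times
    by (rule card_UN_disjoint) (use assms in \<open>auto simp: wfin_def\<close>)
  then show "fps_nth (gf (A \<times> B) (\<lambda>x. w (fst x) + w' (snd x))) t = fps_nth (gf A w * gf B w') t"
    by (simp add: gf_def fps_mult_nth card_cartesian_product)
qed

abbreviation lists_of_length :: "nat \<Rightarrow> nat list set" where
  "lists_of_length d \<equiv> {xs. length xs = d}"

lemma wfin_lists: "wfin (lists_of_length d) sum_list"
  unfolding wfin_def
proof
  fix t
  have "{xs \<in> lists_of_length d. sum_list xs = t} \<subseteq> {xs. set xs \<subseteq> {..t} \<and> length xs = d}"
    using member_le_sum_list by fastforce
  then show "finite {xs \<in> lists_of_length d. sum_list xs = t}"
    by (rule finite_subset) (simp add: finite_lists_length_eq)
qed

lemma gf_lists: "(1 - fps_X) ^ d * gf (lists_of_length d) sum_list = 1"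
proof (induction d)
  case 0
  have "card {xs. xs = [] \<and> sum_list xs = t} = of_bool (t = (0::nat))" for t
    by (cases "t = 0") (auto simp: conj_commute cong: conj_cong)
  then show ?case by (auto simp: gf_def fps_eq_iff)
next
  case (Suc d)
  let ?one = "gf (UNIV :: nat set) id"
  have one: "?one = Abs_fps (\<lambda>_. 1)" by (simp add: gf_def)
  have geo: "(1 - fps_X) * ?one = 1"
    by (simp add: one fps_eq_iff left_diff_distrib fps_X_mult_nth)
  have "gf (lists_of_length (Suc d)) sum_list
      = gf (UNIV \<times> lists_of_length d) (\<lambda>x. id (fst x) + sum_list (snd x))"
    by (rule sym, rule gf_bij_betw[where h = "\<lambda>x. fst x # snd x"])
      (auto simp: bij_betw_def inj_on_def image_iff length_Suc_conv)
  also have "\<dots> = ?one * gf (lists_of_length d) sum_list"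
    by (rule gf_Times[OF _ wfin_lists]) (simp add: wfin_def)
  finally have "(1 - fps_X) ^ Suc d * gf (lists_of_length (Suc d)) sum_list
      = ((1 - fps_X) * ?one) * ((1 - fps_X) ^ d * gf (lists_of_length d) sum_list)"
    by (simp add: algebra_simps)
  then show ?case by (simp only: geo Suc.IH mult_1)
qed

section \<open>Counting flows on acyclic multigraphs\<close>

text \<open>
  A multigraph is given by the list \<open>es\<close> of its edges, parallel edges being repeated, and a flow by the
  list \<open>fs\<close> of its values in the same order. The net flow is the outflow of \<open>v\<close> minus its inflow.
\<close>
definition net :: "(nat \<times> nat) list \<Rightarrow> nat list \<Rightarrow> nat \<Rightarrow> int" where
  "net es fs v = (\<Sum>p<length es. int (fs ! p) * (of_bool (fst (es ! p) = v) - of_bool (snd (es ! p) = v)))"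

text \<open>
  The sum of the positive parts of the net flows; \<^const>\<open>nat\<close> truncates negative integers to 0.
\<close>
definition flow_size :: "nat \<Rightarrow> (nat \<times> nat) list \<Rightarrow> nat list \<Rightarrow> nat" where
  "flow_size n es fs = (\<Sum>v=1..n. nat (net es fs v))"

text \<open>
  The power series \<open>F\<^sub>G\<close> of the multigraph with edges \<open>es\<close>.
\<close>
definition flow_gf :: "nat \<Rightarrow> (nat \<times> nat) list \<Rightarrow> int fps" where
  "flow_gf n es = gf (lists_of_length (length es)) (flow_size n es)"

lemma net_Cons:
  "net (e # es) (f # fs) v = int f * (of_bool (fst e = v) - of_bool (snd e = v)) + net es fs v"
  by (simp add: net_def sum.lessThan_Suc_shift del: sum.lessThan_Suc)

text \<open>
  All edges go from smaller to larger vertices, so weighting the net flow of \<open>v\<close> by \<open>n - v\<close> counts each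
  edge value with the length of its edge, which is at least 1. In particular only finitely many flows
  have a given size.
\<close>
lemma sum_list_le_flow_size:
  assumes "set es \<subseteq> pairs n" "length fs = length es"
  shows "sum_list fs \<le> n * flow_size n es fs"
proof -
  have "int (sum_list fs) = (\<Sum>p<length es. int (fs ! p))"
    using assms(2) by (simp add: sum_list_sum_nth atLeast0LessThan)
  also have "\<dots> \<le> (\<Sum>p<length es. int (fs ! p) * (int (snd (es ! p)) - int (fst (es ! p))))"
  proof (rule sum_mono)
    fix p assume "p \<in> {..<length es}"
    then have "es ! p \<in> pairs n" using assms(1) nth_mem by blast
    then have "1 \<le> int (snd (es ! p)) - int (fst (es ! p))" by (auto simp: pairs_def)
    then show "int (fs ! p) \<le> int (fs ! p) * (int (snd (es ! p)) - int (fst (es ! p)))"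
      by (simp add: mult_le_cancel_left1)
  qed
  also have "\<dots> = (\<Sum>p<length es. \<Sum>v=1..n. (int n - int v) *
      (int (fs ! p) * (of_bool (fst (es ! p) = v) - of_bool (snd (es ! p) = v))))"
  proof (rule sum.cong[OF refl])
    fix p assume "p \<in> {..<length es}"
    then have "es ! p \<in> pairs n" using assms(1) nth_mem by blast
    then have "fst (es ! p) \<in> {1..n}" "snd (es ! p) \<in> {1..n}" by (auto simp: pairs_def)
    moreover have "(\<Sum>v=1..n. (int n - int v) * (of_bool (a = v))) = int n - int a" if "a \<in> {1..n}" for a
      using that by (simp add: of_bool_def if_distrib[of "\<lambda>x. _ * x"] sum.delta cong: if_cong)
    ultimately have "(\<Sum>v=1..n. (int n - int v) * (of_bool (fst (es ! p) = v) - of_bool (snd (es ! p) = v)))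
       = int (snd (es ! p)) - int (fst (es ! p))"
      by (simp add: right_diff_distrib sum_subtractf)
    then show "int (fs ! p) * (int (snd (es ! p)) - int (fst (es ! p))) = (\<Sum>v=1..n. (int n - int v) *
      (int (fs ! p) * (of_bool (fst (es ! p) = v) - of_bool (snd (es ! p) = v))))"
      by (simp flip: sum_distrib_left add: mult.left_commute[of "int n - _"] del: of_bool_eq_iff)
  qed
  also have "\<dots> = (\<Sum>v=1..n. (int n - int v) * net es fs v)"
    by (subst sum.swap) (simp add: net_def sum_distrib_left)
  also have "\<dots> \<le> (\<Sum>v=1..n. int n * int (nat (net es fs v)))"
  proof (rule sum_mono)
    fix v assume "v \<in> {1..n}"
    have "(int n - int v) * net es fs v \<le> (int n - int v) * int (nat (net es fs v))"
      using \<open>v \<in> {1..n}\<close> by (intro mult_left_mono) auto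
    also have "\<dots> \<le> int n * int (nat (net es fs v))" by (intro mult_right_mono) auto
    finally show "(int n - int v) * net es fs v \<le> int n * int (nat (net es fs v))" .
  qed
  also have "\<dots> = int (n * flow_size n es fs)"
    by (simp add: flow_size_def sum_distrib_left)
  finally show ?thesis by linarith
qed

lemma wfin_flow_size:
  assumes "set es \<subseteq> pairs n"
  shows "wfin (lists_of_length (length es)) (flow_size n es)"
  unfolding wfin_def
proof
  fix t
  have "{fs \<in> lists_of_length (length es). flow_size n es fs = t}
      \<subseteq> {fs. set fs \<subseteq> {..n * t} \<and> length fs = length es}"
  proof safe
    fix fs and x :: nat assume "length fs = length es" "x \<in> set fs"
    then show "x \<le> n * flow_size n es fs"
      using sum_list_le_flow_size[OF assms] member_le_sum_list order_trans by blast
  qed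
  then show "finite {fs \<in> lists_of_length (length es). flow_size n es fs = t}"
    by (rule finite_subset) (simp add: finite_lists_length_eq)
qed

lemma flow_gf_cong_mset:
  assumes "mset es = mset es'"
  shows "flow_gf n es = flow_gf n es'"
proof -
  from assms obtain p where p: "p permutes {..<length es'}" and es: "permute_list p es' = es"
    by (rule mset_eq_permutation)
  have len: "length es = length es'" using assms by (rule mset_eq_length)
  have "bij_betw (permute_list p) (lists_of_length (length es')) (lists_of_length (length es))"
  proof (rule bij_betw_byWitness[where f' = "permute_list (inv_into UNIV p)"])
    have ip: "inv_into UNIV p permutes {..<length es'}" using p by (rule permutes_inv)
    show "\<forall>a\<in>lists_of_length (length es'). permute_list (inv_into UNIV p) (permute_list p a) = a"
      using p ip by (auto simp: permute_list_compose[symmetric] permutes_inv_o)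
    show "\<forall>a\<in>lists_of_length (length es). permute_list p (permute_list (inv_into UNIV p) a) = a"
      using p ip len by (auto simp: permute_list_compose[symmetric] permutes_inv_o)
  qed (auto simp: len)
  moreover have "flow_size n es (permute_list p fs) = flow_size n es' fs"
    if "fs \<in> lists_of_length (length es')" for fs
  proof -
    have "net es (permute_list p fs) v = net es' fs v" for v
    proof -
      have "net es (permute_list p fs) v = (\<Sum>k<length es'. int (fs ! p k) *
         (of_bool (fst (es' ! p k) = v) - of_bool (snd (es' ! p k) = v)))"
        unfolding net_def len using that p
        by (intro sum.cong refl) (simp add: permute_list_nth flip: es)
      also have "\<dots> = net es' fs v"
        unfolding net_def by (rule sum.permute[OF p, unfolded comp_def, symmetric])
      finally show ?thesis .
    qed
    then show ?thesis by (simp add: flow_size_def)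
  qed
  ultimately show ?thesis
    unfolding flow_gf_def by (intro gf_bij_betw[symmetric]) auto
qed

text \<open>
  The flows with \<open>a\<close> on \<open>i \<rightarrow> j\<close> and \<open>b\<close> on \<open>j \<rightarrow> k\<close> are covered by those with \<open>b \<le> a\<close> and those with
  \<open>a \<le> b\<close>. Each of the two parts and their intersection is in bijection with the flows of one of the
  graphs on the right-hand side.
\<close>
lemma flow_gf_reduction:
  assumes "set ((i, j) # (j, k) # es) \<subseteq> pairs n"
  shows "flow_gf n ((i, j) # (j, k) # es) =
    flow_gf n ((i, k) # (i, j) # es) + flow_gf n ((j, k) # (i, k) # es) - flow_gf n ((i, k) # es)"
proof -
  let ?es = "(i, j) # (j, k) # es"
  let ?L = "lists_of_length (length ?es)"
  let ?A = "{fs \<in> ?L. fs ! 1 \<le> fs ! 0}" and ?B = "{fs \<in> ?L. fs ! 0 \<le> fs ! 1}"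
  let ?w = "flow_size n ?es"
  have AB: "?A \<union> ?B = ?L" by auto
  have "gf (?A \<union> ?B) ?w = gf ?A ?w + gf ?B ?w - gf (?A \<inter> ?B) ?w"
    by (rule gf_Un_Int) (unfold AB, rule wfin_flow_size[OF assms])
  moreover have "flow_gf n ((i, k) # (i, j) # es) = gf ?A ?w"
    unfolding flow_gf_def
  proof (rule gf_bij_betw)
    show "bij_betw (\<lambda>fs. (fs ! 0 + fs ! 1) # fs ! 0 # drop 2 fs)
       (lists_of_length (length ((i, k) # (i, j) # es))) ?A"
      by (rule bij_betw_byWitness[where f' = "\<lambda>fs. fs ! 1 # (fs ! 0 - fs ! 1) # drop 2 fs"])
        (auto simp: length_Suc_conv)
  qed (auto simp: length_Suc_conv flow_size_def net_Cons algebra_simps)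
  moreover have "flow_gf n ((j, k) # (i, k) # es) = gf ?B ?w"
    unfolding flow_gf_def
  proof (rule gf_bij_betw)
    show "bij_betw (\<lambda>fs. fs ! 1 # (fs ! 0 + fs ! 1) # drop 2 fs)
       (lists_of_length (length ((j, k) # (i, k) # es))) ?B"
      by (rule bij_betw_byWitness[where f' = "\<lambda>fs. (fs ! 1 - fs ! 0) # fs ! 0 # drop 2 fs"])
        (auto simp: length_Suc_conv)
  qed (auto simp: length_Suc_conv flow_size_def net_Cons algebra_simps)
  moreover have "flow_gf n ((i, k) # es) = gf (?A \<inter> ?B) ?w"
    unfolding flow_gf_def
  proof (rule gf_bij_betw)
    show "bij_betw (\<lambda>fs. fs ! 0 # fs) (lists_of_length (length ((i, k) # es))) (?A \<inter> ?B)"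
      by (rule bij_betw_byWitness[where f' = tl]) (auto simp: length_Suc_conv)
  qed (auto simp: length_Suc_conv flow_size_def net_Cons algebra_simps)
  ultimately show ?thesis unfolding AB by (simp add: flow_gf_def)
qed

text \<open>
  If no edge starts where another ends, then the positive part of each net flow is the outflow.
\<close>
lemma flow_gf_alternating:
  assumes "set es \<subseteq> pairs n"
    and alt: "\<And>i j k. (i, j) \<in> set es \<Longrightarrow> (j, k) \<notin> set es"
  shows "(1 - fps_X) ^ length es * flow_gf n es = 1"
proof -
  have "flow_size n es fs = sum_list fs" if "length fs = length es" for fs
  proof -
    have nat_net: "nat (net es fs v) = (\<Sum>p<length es. fs ! p * of_bool (fst (es ! p) = v))" for v
    proof (cases "v \<in> fst ` set es")
      case True
      then obtain k where "(v, k) \<in> set es" by auto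
      then have "snd (es ! p) \<noteq> v" if "p < length es" for p
        using alt[of "fst (es ! p)" v k] nth_mem[OF that] by (metis prod.collapse)
      then have "net es fs v = int (\<Sum>p<length es. fs ! p * of_bool (fst (es ! p) = v))"
        by (auto simp: net_def intro!: sum.cong)
      then show ?thesis by (simp only: nat_int)
    next
      case False
      then have *: "fst (es ! p) \<noteq> v" if "p < length es" for p
        using nth_mem[OF that] by blast
      then have "net es fs v \<le> 0"
        by (auto simp: net_def intro!: sum_nonpos)
      then show ?thesis using * by simp
    qed
    have "flow_size n es fs = (\<Sum>p<length es. \<Sum>v=1..n. fs ! p * of_bool (fst (es ! p) = v))"
      by (subst sum.swap) (simp add: flow_size_def nat_net)
    also have "\<dots> = (\<Sum>p<length es. fs ! p)"
    proof (rule sum.cong[OF refl])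
      fix p assume "p \<in> {..<length es}"
      then have "es ! p \<in> pairs n" using assms(1) nth_mem by blast
      then have "fst (es ! p) \<in> {1..n}" by (auto simp: pairs_def)
      then show "(\<Sum>v=1..n. fs ! p * of_bool (fst (es ! p) = v)) = fs ! p"
        by (simp add: of_bool_def if_distrib[of "\<lambda>x. _ * x"] sum.delta cong: if_cong)
    qed
    also have "\<dots> = sum_list fs" using that by (simp add: sum_list_sum_nth atLeast0LessThan)
    finally show ?thesis .
  qed
  then have "flow_gf n es = gf (lists_of_length (length es)) sum_list"
    unfolding flow_gf_def by (intro gf_bij_betw[where h = id]) auto
  then show ?thesis by (simp add: gf_lists)
qed

section \<open>Invariance under replacements\<close>

text \<open>The monomial of the multigraph with edges \<open>es\<close>.\<close>
definition monom_of :: "(nat \<times> nat) list \<Rightarrow> xmonom" where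
  "monom_of es = (\<Sum>(i, j)\<leftarrow>es. xvar i j)"

lemma monom_of_simps [simp]:
  "monom_of [] = 0" "monom_of ((i, j) # es) = xvar i j + monom_of es"
  by (simp_all add: monom_of_def)

lemma lookup_monom_of: "Poly_Mapping.lookup (monom_of es) = count (mset es)"
proof (induction es)
  case (Cons e es)
  then show ?case
    by (cases e) (auto simp: fun_eq_iff lookup_add xvar_def lookup_single when_def)
qed auto

lemma keys_monom_of: "Poly_Mapping.keys (monom_of es) = set es"
  by (auto simp: in_keys_iff lookup_monom_of)

lemma monom_of_eq_iff: "monom_of es = monom_of es' \<longleftrightarrow> mset es = mset es'"
  by (simp add: poly_mapping_eq_iff multiset_eq_iff fun_eq_iff lookup_monom_of)

lemma ex_monom_of: "\<exists>es. monom_of es = m"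
proof -
  have "finite {x. Poly_Mapping.lookup m x > 0}"
    using finite_lookup[of m] by simp
  moreover obtain es where "mset es = Abs_multiset (Poly_Mapping.lookup m)"
    using ex_mset by blast
  ultimately have "Poly_Mapping.lookup (monom_of es) = Poly_Mapping.lookup m"
    by (simp add: lookup_monom_of)
  then show ?thesis by (auto intro: poly_mapping_eqI)
qed

text \<open>
  The power series \<open>H\<^sub>G\<close> of the multigraph \<open>G\<close> of a monomial. The list of edges is unique only up to
  order, which does not matter by \<open>flow_gf_cong_mset\<close>.
\<close>
definition monom_value :: "nat \<Rightarrow> xmonom \<Rightarrow> int fps" where
  "monom_value n m = (let es = (SOME es. monom_of es = m) in (1 - fps_X) ^ length es * flow_gf n es)"

lemma monom_value_monom_of:
  "monom_value n (monom_of es) = (1 - fps_X) ^ length es * flow_gf n es"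
proof -
  define es' where "es' = (SOME es'. monom_of es' = monom_of es)"
  have "monom_of es' = monom_of es" unfolding es'_def by (rule someI) (rule refl)
  then have "mset es' = mset es" by (simp add: monom_of_eq_iff)
  then have "length es' = length es" "flow_gf n es' = flow_gf n es"
    by (auto intro: mset_eq_length flow_gf_cong_mset)
  then show ?thesis by (simp add: monom_value_def flip: es'_def)
qed

lemma monom_value_reduction:
  assumes "Poly_Mapping.keys (m + xvar i j + xvar j k) \<subseteq> pairs n"
  shows "monom_value n (m + xvar i j + xvar j k) =
    monom_value n (m + xvar i k + xvar i j) + monom_value n (m + xvar j k + xvar i k)
      + (fps_X - 1) * monom_value n (m + xvar i k)"
proof -
  obtain es where m: "m = monom_of es" using ex_monom_of by metis
  have "m + xvar i j + xvar j k = monom_of ((i, j) # (j, k) # es)"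
    "m + xvar i k + xvar i j = monom_of ((i, k) # (i, j) # es)"
    "m + xvar j k + xvar i k = monom_of ((j, k) # (i, k) # es)"
    "m + xvar i k = monom_of ((i, k) # es)"
    by (simp_all add: m add_ac)
  note eqs = this
  have sub: "set ((i, j) # (j, k) # es) \<subseteq> pairs n"
    using assms unfolding eqs(1) keys_monom_of .
  show ?thesis
    unfolding eqs(1) eqs(2) eqs(3)
    \<comment> \<open>The left-hand side of the last equation occurs in the second one, hence the two stages.\<close>
    unfolding eqs(4) monom_value_monom_of flow_gf_reduction[OF sub]
    by (simp add: algebra_simps)
qed

lemma monom_value_reduced:
  assumes "Poly_Mapping.keys m \<subseteq> pairs n"
    and "\<And>i j k m'. i < j \<Longrightarrow> j < k \<Longrightarrow> m \<noteq> m' + xvar i j + xvar j k"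
  shows "monom_value n m = 1"
proof -
  obtain es where m: "m = monom_of es" using ex_monom_of by metis
  have sub: "set es \<subseteq> pairs n" using assms(1) by (simp add: m keys_monom_of)
  have "(j, k) \<notin> set es" if "(i, j) \<in> set es" for i j k
  proof
    assume jk: "(j, k) \<in> set es"
    from that jk sub have less: "i < j" "j < k" by (auto simp: pairs_def)
    from that jk less have "(j, k) \<in># mset es - {#(i, j)#}" "(i, j) \<in># mset es"
      by (auto simp: in_diff_count count_mset_0_iff count_eq_zero_iff)
    then have "mset es = add_mset (i, j) (add_mset (j, k) (mset es - {#(i, j)#} - {#(j, k)#}))"
      by (metis insert_DiffM)
    moreover obtain es' where "mset es' = mset es - {#(i, j)#} - {#(j, k)#}"
      using ex_mset by blast
    ultimately have "m = monom_of ((i, j) # (j, k) # es')"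
      by (simp add: m monom_of_eq_iff del: monom_of_simps)
    then have "m = monom_of es' + xvar i j + xvar j k" by (simp add: add_ac)
    with assms(2)[OF less] show False by blast
  qed
  from flow_gf_alternating[OF sub this] show ?thesis
    by (simp add: m monom_value_monom_of)
qed

text \<open>
  The substitution of \<open>q - 1\<close> for \<open>\<beta>\<close>, with values in power series in \<open>q\<close>.
\<close>
definition shift_fps :: "int poly \<Rightarrow> int fps" where
  "shift_fps c = fps_of_poly (pcompose c [:-1, 1:])"

lemma shift_fps_simps:
  "shift_fps 0 = 0" "shift_fps (a + b) = shift_fps a + shift_fps b"
  "shift_fps (a - b) = shift_fps a - shift_fps b" "shift_fps (a * b) = shift_fps a * shift_fps b"
  "shift_fps 1 = 1" "shift_fps [:0, 1:] = fps_X - 1"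
  by (simp_all add: shift_fps_def pcompose_add pcompose_diff pcompose_mult pcompose_pCons
      fps_of_poly_add fps_of_poly_diff fps_of_poly_mult pcompose_1 fps_of_poly_pCons)

lemma shift_fps_sum: "shift_fps (sum f A) = (\<Sum>x\<in>A. shift_fps (f x))"
  by (induction A rule: infinite_finite_induct) (simp_all add: shift_fps_simps)

text \<open>
  The linear extension of \<^const>\<open>monom_value\<close> to polynomials, where \<open>\<beta>\<close> acts as \<open>q - 1\<close>.
\<close>
definition flow_value :: "nat \<Rightarrow> xpoly \<Rightarrow> int fps" where
  "flow_value n P = (\<Sum>m\<in>Poly_Mapping.keys P. shift_fps (Poly_Mapping.lookup P m) * monom_value n m)"

lemma flow_value_superset:
  assumes "finite S" "Poly_Mapping.keys P \<subseteq> S"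
  shows "flow_value n P = (\<Sum>m\<in>S. shift_fps (Poly_Mapping.lookup P m) * monom_value n m)"
  unfolding flow_value_def
  by (rule sum.mono_neutral_left) (use assms in \<open>auto simp: in_keys_iff shift_fps_simps\<close>)

lemma flow_value_add: "flow_value n (P + R) = flow_value n P + flow_value n R"
proof -
  let ?S = "Poly_Mapping.keys P \<union> Poly_Mapping.keys R"
  have "Poly_Mapping.keys (P + R) \<subseteq> ?S" by (rule Poly_Mapping.keys_add)
  then show ?thesis
    by (simp add: flow_value_superset[of ?S] lookup_add shift_fps_simps distrib_right sum.distrib)
qed

lemma flow_value_single: "flow_value n (Poly_Mapping.single m c) = shift_fps c * monom_value n m"
  by (subst flow_value_superset[of "{m}"]) auto

lemma flow_value_diff: "flow_value n (P - R) = flow_value n P - flow_value n R"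
  using flow_value_add[of n "P - R" R] by simp

lemma flow_value_reduction_step:
  assumes "vars_in n P" "reduction_step P R"
  shows "flow_value n R = flow_value n P"
proof -
  from assms(2) obtain i j k m where
    M: "m + xvar i j + xvar j k \<in> Poly_Mapping.keys P"
    and R: "R = P - Poly_Mapping.single (m + xvar i j + xvar j k)
                      (Poly_Mapping.lookup P (m + xvar i j + xvar j k))
       + Poly_Mapping.single m (Poly_Mapping.lookup P (m + xvar i j + xvar j k))
         * (X i k * X i j + X j k * X i k + Beta * X i k)"
    by (auto simp: reduction_step_def Let_def)
  have "Poly_Mapping.keys (m + xvar i j + xvar j k) \<subseteq> pairs n"
    using assms(1) M unfolding vars_in_def by blast
  note mv = monom_value_reduction[OF this]
  show ?thesis
    unfolding R replacement_eq flow_value_add flow_value_diff flow_value_single mv shift_fps_simps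
    by (simp add: algebra_simps)
qed

lemma flow_value_reduction_steps:
  assumes "reduction_step\<^sup>*\<^sup>* P R" "vars_in n P"
  shows "vars_in n R \<and> flow_value n R = flow_value n P"
  using assms
  by (induction rule: rtranclp_induct)
    (auto simp: flow_value_reduction_step dest: reduction_step_decreases)

lemma flow_value_reduced:
  assumes "vars_in n P" "is_reduced P"
  shows "flow_value n P = shift_fps (eval_xpoly (\<lambda>_. 1) P)"
proof -
  have "monom_value n m = 1" if "m \<in> Poly_Mapping.keys P" for m
    using assms that by (intro monom_value_reduced) (auto simp: vars_in_def is_reduced_def)
  then show ?thesis
    by (simp add: flow_value_def eval_xpoly_def shift_fps_sum)
qed

lemma shift_fps_reduced_polynomial:
  assumes "set es = pairs n" "distinct es" "reduced_polynomial_of (w0 n) P"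
  shows "shift_fps (eval_xpoly (\<lambda>_. 1) P) = (1 - fps_X) ^ (n choose 2) * flow_gf n es"
proof -
  have "(\<Sum>(i, j)\<in>pairs n. xvar i j) = monom_of es"
    unfolding monom_of_def assms(1)[symmetric] by (rule sum_list_distinct_conv_sum_set[OF assms(2), symmetric])
  then have w0: "w0 n = Poly_Mapping.single (monom_of es) 1" by (simp add: w0_eq)
  have "vars_in n (w0 n)" by (simp add: w0 vars_in_def keys_monom_of assms(1))
  with assms(3) have "shift_fps (eval_xpoly (\<lambda>_. 1) P) = flow_value n (w0 n)"
    using flow_value_reduction_steps flow_value_reduced unfolding reduced_polynomial_of_def by metis
  also have "\<dots> = (1 - fps_X) ^ length es * flow_gf n es"
    by (simp add: w0 flow_value_single shift_fps_simps monom_value_monom_of)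
  also have "length es = n choose 2"
  proof -
    have "pairs n = (\<Union>j\<in>{..n}. (\<lambda>i. (i, j)) ` {1..<j})" by (auto simp: pairs_def)
    moreover have "card (\<Union>j\<in>{..n}. (\<lambda>i. (i, j)) ` {1..<j}) = (\<Sum>j\<in>{..n}. card ((\<lambda>i. (i, j)) ` {1..<j}))"
      by (rule card_UN_disjoint) auto
    moreover have "(\<Sum>j\<in>{..n}. card ((\<lambda>i. (i, j)) ` {1..<j})) = (\<Sum>j\<le>n. j - 1)"
      by (intro sum.cong refl) (simp add: card_image inj_on_def)
    moreover have "(\<Sum>j\<le>n. j - 1) = n choose 2"
      by (induction n) (auto simp: numeral_2_eq_2)
    ultimately have "card (pairs n) = n choose 2" by simp
    then show ?thesis using distinct_card[OF assms(2)] assms(1) by simp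
  qed
  finally show ?thesis .
qed

section \<open>Integer points of the Chan--Robbins--Yuen polytope\<close>

text \<open>
  The lower triangular array \<open>a\<close> encodes the flow on the complete graph on \<open>0, \<dots>, n + 1\<close> whose value on
  the edge \<open>j \<rightarrow> i + 1\<close> is \<open>a i j\<close>. The sum of row \<open>v\<close> is the inflow of the vertex \<open>v + 1\<close> and the sum of
  column \<open>v + 1\<close> is its outflow; they agree for the inner vertices \<open>1, \<dots>, n\<close>.
\<close>
definition balanced_arrays :: "nat \<Rightarrow> (nat \<Rightarrow> nat \<Rightarrow> nat) set" where
  "balanced_arrays n = {a. (\<forall>i j. a i j \<noteq> 0 \<longrightarrow> j \<le> i \<and> i \<le> n) \<and>
     (\<forall>v<n. (\<Sum>j\<le>n. a v j) = (\<Sum>i\<le>n. a i (Suc v)))}"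

text \<open>The outflow of the source \<open>0\<close>.\<close>
definition array_value :: "nat \<Rightarrow> (nat \<Rightarrow> nat \<Rightarrow> nat) \<Rightarrow> nat" where
  "array_value n a = (\<Sum>i\<le>n. a i 0)"

text \<open>
  The integer points of the \<open>m\<close>-th dilate of the polytope of matrices of size \<open>n + 1\<close>, as functions that
  vanish outside the matrix.
\<close>
definition hessenberg_arrays :: "nat \<Rightarrow> nat \<Rightarrow> (nat \<Rightarrow> nat \<Rightarrow> nat) set" where
  "hessenberg_arrays n m = {c. (\<forall>i j. c i j \<noteq> 0 \<longrightarrow> i \<le> n \<and> j \<le> n \<and> j \<le> Suc i) \<and>
     (\<forall>j\<le>n. (\<Sum>i\<le>n. c i j) = m) \<and> (\<forall>i\<le>n. (\<Sum>j\<le>n. c i j) = m)}"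

lemma lattice_points_CRY:
  "{B \<in> (\<lambda>A. real m \<cdot>\<^sub>m A) ` CRY (Suc n). elements_mat B \<subseteq> \<int>}
     = (\<lambda>c. mat (Suc n) (Suc n) (\<lambda>(i, j). real (c i j))) ` hessenberg_arrays n m"
  (is "?L = ?M ` _")
proof (intro equalityI subsetI)
  fix B assume "B \<in> ?L"
  then have "B \<in> (\<lambda>A. real m \<cdot>\<^sub>m A) ` CRY (Suc n)" and ints: "elements_mat B \<subseteq> \<int>"
    by simp_all
  then obtain A where A: "A \<in> CRY (Suc n)" and B: "B = real m \<cdot>\<^sub>m A" by (elim imageE)
  have "A \<in> carrier_mat (Suc n) (Suc n)"
    and nonneg: "\<And>i j. i < Suc n \<Longrightarrow> j < Suc n \<Longrightarrow> 0 \<le> A $$ (i, j)"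
    and col_sum: "\<And>j. j < Suc n \<Longrightarrow> (\<Sum>i<Suc n. A $$ (i, j)) = 1"
    and row_sum: "\<And>i. i < Suc n \<Longrightarrow> (\<Sum>j<Suc n. A $$ (i, j)) = 1"
    and zero: "\<And>i j. i < Suc n \<Longrightarrow> j < Suc n \<Longrightarrow> i + 1 < j \<Longrightarrow> A $$ (i, j) = 0"
    using A by (simp_all add: CRY_def del: sum.lessThan_Suc)
  from carrier_matD[OF this(1)] have dim: "dim_row A = Suc n" "dim_col A = Suc n" .
  define c where "c i j = (if i \<le> n \<and> j \<le> n then nat \<lfloor>B $$ (i, j)\<rfloor> else 0)" for i j
  have c: "real (c i j) = real m * A $$ (i, j)" if "i \<le> n" "j \<le> n" for i j
  proof -
    have "B \<in> carrier_mat (Suc n) (Suc n)" by (rule carrier_matI) (simp_all add: B dim)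
    then have "B $$ (i, j) \<in> elements_mat B"
      by (rule elements_matI[of _ _ _ i j]) (use that in simp_all)
    then have "B $$ (i, j) \<in> \<int>" using ints by blast
    then obtain z where z: "B $$ (i, j) = of_int z" by (rule Ints_cases)
    have eq: "B $$ (i, j) = real m * A $$ (i, j)" using that by (simp add: B dim)
    then have "0 \<le> real_of_int z" unfolding z using nonneg[of i j] that by simp
    then have "0 \<le> z" by simp
    then have "real (c i j) = B $$ (i, j)" unfolding c_def z using that by simp
    then show ?thesis unfolding eq .
  qed
  have "B = ?M c" by (rule eq_matI) (auto simp: B dim c)
  moreover have "c \<in> hessenberg_arrays n m"
  proof -
    have "(\<Sum>i\<le>n. c i j) = m" if "j \<le> n" for j
    proof -
      have "real (\<Sum>i\<le>n. c i j) = real m * (\<Sum>i<Suc n. A $$ (i, j))"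
        using that by (simp add: c sum_distrib_left lessThan_Suc_atMost del: sum.lessThan_Suc)
      also have "(\<Sum>i<Suc n. A $$ (i, j)) = 1" using that by (intro col_sum) simp
      finally show ?thesis by (simp only: mult_1_right of_nat_eq_iff)
    qed
    moreover have "(\<Sum>j\<le>n. c i j) = m" if "i \<le> n" for i
    proof -
      have "real (\<Sum>j\<le>n. c i j) = real m * (\<Sum>j<Suc n. A $$ (i, j))"
        using that by (simp add: c sum_distrib_left lessThan_Suc_atMost del: sum.lessThan_Suc)
      also have "(\<Sum>j<Suc n. A $$ (i, j)) = 1" using that by (intro row_sum) simp
      finally show ?thesis by (simp only: mult_1_right of_nat_eq_iff)
    qed
    moreover have "i \<le> n \<and> j \<le> n \<and> j \<le> Suc i" if "c i j \<noteq> 0" for i j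
    proof -
      have "i \<le> n" "j \<le> n" using that by (auto simp: c_def split: if_splits)
      moreover have "A $$ (i, j) \<noteq> 0" using that c[OF calculation] by auto
      ultimately show ?thesis using zero[of i j] by linarith
    qed
    ultimately show ?thesis unfolding hessenberg_arrays_def by blast
  qed
  ultimately show "B \<in> ?M ` hessenberg_arrays n m" by blast
next
  fix B assume "B \<in> ?M ` hessenberg_arrays n m"
  then obtain c where c: "c \<in> hessenberg_arrays n m" and B: "B = ?M c" by blast
  have col_sum: "\<And>j. j \<le> n \<Longrightarrow> (\<Sum>i\<le>n. c i j) = m"
    and row_sum: "\<And>i. i \<le> n \<Longrightarrow> (\<Sum>j\<le>n. c i j) = m"
    and zero: "\<And>i j. \<not> j \<le> Suc i \<Longrightarrow> c i j = 0"
    using c unfolding hessenberg_arrays_def by blast+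
  have ints: "elements_mat B \<subseteq> \<int>"
    unfolding elements_mat_def by (auto simp: B)
  show "B \<in> ?L"
  proof (cases "m = 0")
    case True
    have "c i j = 0" if "i \<le> n" "j \<le> n" for i j
    proof -
      have "(\<Sum>l\<le>n. c i l) = 0" using row_sum[OF that(1)] True by simp
      then show ?thesis using that by simp
    qed
    \<comment> \<open>The dilate by 0 consists of the zero matrix only because the polytope is not empty.\<close>
    then have "B = real m \<cdot>\<^sub>m 1\<^sub>m (Suc n)" by (intro eq_matI) (auto simp: B True)
    moreover have "1\<^sub>m (Suc n) \<in> CRY (Suc n)"
    proof -
      have "(\<Sum>i<Suc n. 1\<^sub>m (Suc n) $$ (i, j)) = (1 :: real)"
        "(\<Sum>i<Suc n. 1\<^sub>m (Suc n) $$ (j, i)) = (1 :: real)" if "j < Suc n" for j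
        using that by (simp_all add: one_mat_def sum.delta del: sum.lessThan_Suc)
      then show ?thesis unfolding CRY_def by simp
    qed
    ultimately show ?thesis using ints by blast
  next
    case False
    define A where "A = mat (Suc n) (Suc n) (\<lambda>(i, j). real (c i j) / real m)"
    have "B = real m \<cdot>\<^sub>m A" by (rule eq_matI) (auto simp: A_def B False)
    moreover have "A \<in> CRY (Suc n)"
    proof -
      have "(\<Sum>i<Suc n. A $$ (i, j)) = 1" if "j < Suc n" for j
      proof -
        have "(\<Sum>i<Suc n. A $$ (i, j)) = (\<Sum>i<Suc n. real (c i j) / real m)"
          using that by (intro sum.cong) (auto simp: A_def)
        also have "\<dots> = real (\<Sum>i\<le>n. c i j) / real m"
          by (simp add: lessThan_Suc_atMost sum_divide_distrib del: sum.lessThan_Suc)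
        finally show ?thesis using that False by (simp add: col_sum)
      qed
      moreover have "(\<Sum>j<Suc n. A $$ (i, j)) = 1" if "i < Suc n" for i
      proof -
        have "(\<Sum>j<Suc n. A $$ (i, j)) = (\<Sum>j<Suc n. real (c i j) / real m)"
          using that by (intro sum.cong) (auto simp: A_def)
        also have "\<dots> = real (\<Sum>j\<le>n. c i j) / real m"
          by (simp add: lessThan_Suc_atMost sum_divide_distrib del: sum.lessThan_Suc)
        finally show ?thesis using that False by (simp add: row_sum)
      qed
      moreover have "A $$ (i, j) = 0" if "i < Suc n" "j < Suc n" "j > i + 1" for i j
        using that zero[of j i] by (simp add: A_def)
      moreover have "A \<in> carrier_mat (Suc n) (Suc n)"
        "\<And>i j. i < Suc n \<Longrightarrow> j < Suc n \<Longrightarrow> 0 \<le> A $$ (i, j)"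
        by (simp_all add: A_def)
      ultimately show ?thesis
        unfolding CRY_def by blast
    qed
    ultimately show ?thesis using ints by blast
  qed
qed

lemma ehrhart_CRY: "ehrhart (CRY (Suc n)) m = card (hessenberg_arrays n m)"
proof -
  let ?M = "\<lambda>c. mat (Suc n) (Suc n) (\<lambda>(i, j). real (c i j :: nat))"
  have "inj_on ?M (hessenberg_arrays n m)"
  proof (rule inj_onI)
    fix c c' assume c: "c \<in> hessenberg_arrays n m" "c' \<in> hessenberg_arrays n m" "?M c = ?M c'"
    have "c i j = c' i j" for i j
    proof (cases "i \<le> n \<and> j \<le> n")
      case True
      then have "?M c $$ (i, j) = ?M c' $$ (i, j)" using c(3) by simp
      with True show ?thesis by simp
    next
      case False
      then have "c i j = 0" "c' i j = 0" using c(1,2) by (auto simp: hessenberg_arrays_def)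
      then show ?thesis by simp
    qed
    then show "c = c'" by blast
  qed
  then show ?thesis
    unfolding ehrhart_def lattice_points_CRY by (rule card_image)
qed

text \<open>
  No vertex receives more than the source emits. The two sides of the cut after vertex \<open>i\<close> are compared:
  rows \<open>0, \<dots>, i\<close> are supported in columns \<open>0, \<dots>, i\<close>, and by balance the total of those columns exceeds
  the total of rows \<open>0, \<dots>, i - 1\<close> by the outflow of the source.
\<close>
lemma balanced_arrays_row_le:
  assumes "a \<in> balanced_arrays n" "i \<le> n"
  shows "(\<Sum>j\<le>n. a i j) \<le> array_value n a"
    and "i = n \<Longrightarrow> (\<Sum>j\<le>n. a i j) = array_value n a"
proof -
  have supp: "a k j = 0" if "\<not> (j \<le> k \<and> k \<le> n)" for k j
    using assms(1) that unfolding balanced_arrays_def by blast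
  have bal: "(\<Sum>j\<le>n. a v j) = (\<Sum>k\<le>n. a k (Suc v))" if "v < n" for v
    using assms(1) that by (simp add: balanced_arrays_def)
  have rows: "(\<Sum>k\<le>i. \<Sum>j\<le>n. a k j) = (\<Sum>j\<le>i. \<Sum>k\<le>i. a k j)"
  proof -
    have "(\<Sum>k\<le>i. \<Sum>j\<le>n. a k j) = (\<Sum>k\<le>i. \<Sum>j\<le>i. a k j)"
      using assms(2) by (intro sum.cong refl sum.mono_neutral_right) (auto intro!: supp)
    then show ?thesis by (subst sum.swap)
  qed
  have "(\<Sum>j\<le>i. \<Sum>k\<le>n. a k j) = array_value n a + (\<Sum>v<i. \<Sum>k\<le>n. a k (Suc v))"
    unfolding array_value_def by (rule sum.atMost_shift)
  also have "(\<Sum>v<i. \<Sum>k\<le>n. a k (Suc v)) = (\<Sum>v<i. \<Sum>j\<le>n. a v j)"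
    by (rule sum.cong[OF refl], rule bal[symmetric]) (use assms(2) in simp)
  finally have cols: "(\<Sum>j\<le>i. \<Sum>k\<le>n. a k j) = array_value n a + (\<Sum>v<i. \<Sum>j\<le>n. a v j)" .
  have le: "(\<Sum>j\<le>i. \<Sum>k\<le>i. a k j) \<le> (\<Sum>j\<le>i. \<Sum>k\<le>n. a k j)"
    using assms(2) by (intro sum_mono sum_mono2) auto
  have "(\<Sum>k\<le>i. \<Sum>j\<le>n. a k j) = (\<Sum>v<i. \<Sum>j\<le>n. a v j) + (\<Sum>j\<le>n. a i j)"
    by (simp flip: lessThan_Suc_atMost)
  then show "(\<Sum>j\<le>n. a i j) \<le> array_value n a" "i = n \<Longrightarrow> (\<Sum>j\<le>n. a i j) = array_value n a"
    using rows cols le by auto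
qed

text \<open>
  Deleting the superdiagonal loses nothing: the entry in row \<open>i\<close> is what the rest of the row lacks to the
  sum \<open>m\<close>, and by balance the rest of its column lacks the same amount.
\<close>
lemma hessenberg_arrays_bij_betw:
  "bij_betw (\<lambda>c i j. if j \<le> i then c i j else 0)
     (hessenberg_arrays n m) {a \<in> balanced_arrays n. array_value n a = m}"
proof (rule bij_betw_byWitness[where
      f' = "\<lambda>a i j. a i j + (if i < n \<and> j = Suc i then m - (\<Sum>l\<le>n. a i l) else 0)"])
  let ?low = "\<lambda>c i j. if j \<le> i then c i j else (0::nat)"
  let ?up = "\<lambda>a i j. a i j + (if i < n \<and> j = Suc i then m - (\<Sum>l\<le>n. a i l) else (0::nat))"
  have supp: "c k l = 0" if "c \<in> hessenberg_arrays n m" "\<not> l \<le> Suc k" for c k l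
    using that unfolding hessenberg_arrays_def by blast
  have row: "(\<Sum>j\<le>n. ?low c i j) + c i (Suc i) = m" if "c \<in> hessenberg_arrays n m" "i < n" for c i
  proof -
    have "(\<Sum>j\<le>n. c i j) = (\<Sum>j\<le>n. ?low c i j + (if j = Suc i then c i (Suc i) else 0))"
      using that by (intro sum.cong) (auto simp: supp)
    then show ?thesis using that by (simp add: sum.distrib hessenberg_arrays_def)
  qed
  have col: "(\<Sum>i\<le>n. ?low c i (Suc v)) + c v (Suc v) = m" if "c \<in> hessenberg_arrays n m" "v < n" for c v
  proof -
    have "(\<Sum>i\<le>n. c i (Suc v)) = (\<Sum>i\<le>n. ?low c i (Suc v) + (if i = v then c v (Suc v) else 0))"
      using that by (intro sum.cong) (auto simp: supp)
    then show ?thesis using that by (simp add: sum.distrib hessenberg_arrays_def)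
  qed
  show "?low ` hessenberg_arrays n m \<subseteq> {a \<in> balanced_arrays n. array_value n a = m}"
  proof safe
    fix c assume c: "c \<in> hessenberg_arrays n m"
    have "(\<Sum>j\<le>n. ?low c v j) = (\<Sum>i\<le>n. ?low c i (Suc v))" if "v < n" for v
      using row[OF c that] col[OF c that] by linarith
    then show "?low c \<in> balanced_arrays n"
      using c by (auto simp: balanced_arrays_def hessenberg_arrays_def split: if_splits)
    show "array_value n (?low c) = m"
      using c by (simp add: array_value_def hessenberg_arrays_def)
  qed
  show "\<forall>c\<in>hessenberg_arrays n m. ?up (?low c) = c"
  proof (intro ballI ext)
    fix c i j assume c: "c \<in> hessenberg_arrays n m"
    consider "i < n" "j = Suc i" | "j \<le> i" | "\<not> (j \<le> i)" "\<not> (i < n \<and> j = Suc i)" by linarith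
    then show "?up (?low c) i j = c i j"
    proof cases
      case 1
      then show ?thesis using row[OF c 1(1)] by simp
    next
      case 3
      then have "c i j = 0" using c unfolding hessenberg_arrays_def by fastforce
      with 3 show ?thesis by auto
    qed auto
  qed
  show "\<forall>a\<in>{a \<in> balanced_arrays n. array_value n a = m}. ?low (?up a) = a"
    by (fastforce simp: balanced_arrays_def fun_eq_iff)
  show "?up ` {a \<in> balanced_arrays n. array_value n a = m} \<subseteq> hessenberg_arrays n m"
  proof (rule image_subsetI)
    fix a assume "a \<in> {a \<in> balanced_arrays n. array_value n a = m}"
    then have a: "a \<in> balanced_arrays n" and m: "m = array_value n a" by auto
    have "i \<le> n \<and> j \<le> n \<and> j \<le> Suc i" if "?up a i j \<noteq> 0" for i j
    proof (cases "a i j = 0")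
      case True
      then show ?thesis using that by (auto split: if_splits)
    next
      case False
      then have "j \<le> i \<and> i \<le> n" using a unfolding balanced_arrays_def by blast
      then show ?thesis by simp
    qed
    moreover have "(\<Sum>j\<le>n. ?up a i j) = m" if "i \<le> n" for i
      using balanced_arrays_row_le[OF a that] that m
      by (cases "i = n") (auto simp: sum.distrib)
    moreover have "(\<Sum>i\<le>n. ?up a i j) = m" if "j \<le> n" for j
    proof (cases j)
      case 0
      then show ?thesis by (simp add: m array_value_def)
    next
      case (Suc v)
      then have "(\<Sum>l\<le>n. a v l) = (\<Sum>i\<le>n. a i (Suc v))" and "(\<Sum>l\<le>n. a v l) \<le> m"
        using a that m balanced_arrays_row_le[OF a, of v] by (auto simp: balanced_arrays_def)
      moreover have "(\<Sum>i\<le>n. if i < n \<and> j = Suc i then m - (\<Sum>l\<le>n. a i l) else 0)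
          = (\<Sum>i\<le>n. if i = v then m - (\<Sum>l\<le>n. a v l) else 0)"
        using Suc that by (intro sum.cong) auto
      ultimately show ?thesis using Suc that by (simp add: sum.distrib)
    qed
    ultimately show "?up a \<in> hessenberg_arrays n m"
      unfolding hessenberg_arrays_def by blast
  qed
qed

lemma ehrhart_series_CRY:
  "Abs_fps (\<lambda>m. int (ehrhart (CRY (n + 1)) m)) = gf (balanced_arrays n) (array_value n)"
  using bij_betw_same_card[OF hessenberg_arrays_bij_betw] by (simp add: gf_def ehrhart_CRY)

text \<open>
  For flows on the complete graph on \<open>1, \<dots>, n\<close> that are given by a function on pairs of vertices.
\<close>
lemma net_map:
  assumes "set es = pairs n" "distinct es" "v \<in> {1..n}"
    and g: "\<And>e. e \<in> {1..n} \<times> {1..n} - pairs n \<Longrightarrow> g e = 0"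
  shows "net es (map g es) v = int (\<Sum>j=1..n. g (v, j)) - int (\<Sum>i=1..n. g (i, v))"
proof -
  let ?t = "\<lambda>e. int (g e) * (of_bool (fst e = v) - of_bool (snd e = v))"
  have "net es (map g es) v = (\<Sum>p<length es. ?t (es ! p))"
    by (simp add: net_def)
  also have "\<dots> = (\<Sum>e\<in>pairs n. ?t e)"
    by (rule sum.reindex_bij_betw) (use assms in \<open>auto intro: bij_betw_nth\<close>)
  also have "\<dots> = (\<Sum>e\<in>{1..n} \<times> {1..n}. ?t e)"
    by (rule sum.mono_neutral_left) (auto simp: pairs_def g)
  also have "\<dots> = (\<Sum>i=1..n. \<Sum>j=1..n. int (g (i, j)) * of_bool (i = v))
       - (\<Sum>i=1..n. \<Sum>j=1..n. int (g (i, j)) * of_bool (j = v))"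
    by (simp add: sum.cartesian_product' right_diff_distrib sum_subtractf del: sum_of_bool_mult_eq)
  also have "(\<Sum>i=1..n. \<Sum>j=1..n. int (g (i, j)) * of_bool (i = v)) = (\<Sum>j=1..n. int (g (v, j)))"
    using assms(3) by (subst sum.swap) (simp add: of_bool_def if_distrib[of "\<lambda>x. _ * x"] sum.delta cong: if_cong)
  also have "(\<Sum>i=1..n. \<Sum>j=1..n. int (g (i, j)) * of_bool (j = v)) = (\<Sum>i=1..n. int (g (i, v)))"
    using assms(3) by (simp add: of_bool_def if_distrib[of "\<lambda>x. _ * x"] sum.delta cong: if_cong)
  finally show ?thesis by simp
qed

text \<open>
  A flow on the complete graph on \<open>0, \<dots>, n + 1\<close> splits into its restriction \<open>fs\<close> to the edges inside
  \<open>1, \<dots>, n\<close> and a list \<open>cs\<close> of \<open>n + 1\<close> independent numbers: \<open>cs ! 0\<close> is the value on the edge from the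
  source to the sink, and \<open>cs ! v\<close> the minimum of the values on the edges from the source to \<open>v\<close> and from
  \<open>v\<close> to the sink. These two values differ by the net flow of \<open>v\<close>, so one of them is \<open>cs ! v\<close> and the
  other exceeds it by the absolute value of the net flow.
\<close>
lemma balanced_arrays_gf:
  assumes es: "set es = pairs n" "distinct es"
  shows "gf (balanced_arrays n) (array_value n) = flow_gf n es * gf (lists_of_length (Suc n)) sum_list"
proof -
  let ?fc = "lists_of_length (length es) \<times> lists_of_length (Suc n)"
  \<comment> \<open>The value of the flow \<open>fs\<close> on the edge \<open>e\<close>, and 0 if there is no such edge.\<close>
  define ff where "ff fs e = (case map_of (zip es fs) e of None \<Rightarrow> 0 | Some x \<Rightarrow> x)" for fs :: "nat list" and e
  \<comment> \<open>Column 0 holds the edges from the source, row \<open>n\<close> those to the sink.\<close>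
  define arr where "arr fs cs i j = (if j = 0
      then if i < n then nat (net es fs (Suc i)) + cs ! Suc i else if i = n then cs ! 0 else 0
      else if i < n then ff fs (j, Suc i) else if i = n \<and> j \<le> n then nat (- net es fs j) + cs ! j else 0)"
    for fs cs i j
  define flows where "flows a = map (\<lambda>(i, j). a (j - 1) i :: nat) es" for a :: "nat \<Rightarrow> nat \<Rightarrow> nat"
  define loops where "loops a = a n 0 # map (\<lambda>v. min (a v 0) (a n (Suc v))) [0..<n]" for a :: "nat \<Rightarrow> nat \<Rightarrow> nat"
  have ff_supp: "ff fs e = 0" if "e \<notin> pairs n" "length fs = length es" for fs e
    using that es(1) by (auto simp: ff_def split: option.splits dest!: map_of_SomeD set_zip_leftD)
  have map_ff: "map (ff fs) es = fs" if "length fs = length es" for fs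
    using that es(2) by (intro nth_equalityI) (auto simp: ff_def map_of_zip_nth)
  have ff_map: "ff (map g es) e = g e" if "e \<in> pairs n" for g e
    using that es(1) by (simp add: ff_def map_of_zip_map)
  have row: "(\<Sum>j\<le>n. h j) = h 0 + (\<Sum>j=1..n. h j)" for h :: "nat \<Rightarrow> nat"
    by (simp add: atMost_atLeast0 sum.atLeast_Suc_atMost)
  have col: "(\<Sum>i\<le>n. h i) = (\<Sum>j=1..n. h (j - 1)) + h n" for h :: "nat \<Rightarrow> nat"
  proof -
    have "(\<Sum>j=1..n. h (j - 1)) = (\<Sum>i<n. h i)"
      by (rule sum.reindex_bij_witness[of _ Suc "\<lambda>j. j - 1"]) auto
    then show ?thesis by (simp flip: lessThan_Suc_atMost)
  qed
  have net_arr: "net es fs v = int (\<Sum>j=1..n. ff fs (v, j)) - int (\<Sum>i=1..n. ff fs (i, v))"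
    if "length fs = length es" "v \<in> {1..n}" for fs v
    using net_map[OF es that(2), of "ff fs"] that ff_supp map_ff[OF that(1)] by auto
  have net_flows: "int (a v 0) - int (a n (Suc v)) = net es (flows a) (Suc v)"
    if a: "a \<in> balanced_arrays n" and v: "v < n" for a v
  proof -
    have zero: "a (l - Suc 0) k = 0" if "1 \<le> l" "\<not> k < l" for k l
    proof -
      have "\<not> k \<le> l - Suc 0" using that by linarith
      then show ?thesis using a unfolding balanced_arrays_def by blast
    qed
    have "net es (flows a) (Suc v) = int (\<Sum>j=1..n. (\<lambda>(i, j). a (j - 1) i) (Suc v, j))
        - int (\<Sum>i=1..n. (\<lambda>(i, j). a (j - 1) i) (i, Suc v))"
      unfolding flows_def
    proof (rule net_map[OF es])
      fix e assume e: "e \<in> {1..n} \<times> {1..n} - pairs n"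
      obtain k l where kl: "e = (k, l)" by (cases e)
      then have "1 \<le> l" "\<not> k < l" using e by (auto simp: pairs_def)
      then show "(\<lambda>(i, j). a (j - 1) i) e = 0" by (simp add: kl zero)
    qed (use v in simp)
    then have "net es (flows a) (Suc v) = int (\<Sum>j=1..n. a (j - 1) (Suc v)) - int (\<Sum>i=1..n. a v i)"
      by simp
    moreover have "(\<Sum>j\<le>n. a v j) = (\<Sum>i\<le>n. a i (Suc v))" using a v by (simp add: balanced_arrays_def)
    ultimately show ?thesis unfolding row[of "a v"] col[of "\<lambda>i. a i (Suc v)"] by linarith
  qed
  have bij: "bij_betw (\<lambda>(fs, cs). arr fs cs) ?fc (balanced_arrays n)"
  proof (rule bij_betw_byWitness[where f' = "\<lambda>a. (flows a, loops a)"])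
    show "\<forall>x\<in>?fc. (\<lambda>a. (flows a, loops a)) ((\<lambda>(fs, cs). arr fs cs) x) = x"
    proof safe
      fix fs cs :: "nat list" assume len: "length fs = length es" "length cs = Suc n"
      have "map (\<lambda>(i, j). arr fs cs (j - 1) i) es = map (ff fs) es"
      proof (rule map_cong[OF refl])
        fix e assume "e \<in> set es"
        then obtain i j where "e = (i, j)" "1 \<le> i" "i < j" "j \<le> n"
          using es(1) by (auto simp: pairs_def)
        then show "(\<lambda>(i, j). arr fs cs (j - 1) i) e = ff fs e" by (simp add: arr_def)
      qed
      then show "flows (arr fs cs) = fs" by (simp add: flows_def map_ff len)
      show "loops (arr fs cs) = cs"
      proof (rule nth_equalityI)
        fix v assume v: "v < length (loops (arr fs cs))"
        show "loops (arr fs cs) ! v = cs ! v"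
        proof (cases v)
          case 0
          then show ?thesis by (simp add: loops_def arr_def)
        next
          case (Suc u)
          then have u: "u < n" using v by (simp add: loops_def)
          then have "arr fs cs u 0 = nat (net es fs v) + cs ! v"
            "arr fs cs n v = nat (- net es fs v) + cs ! v"
            by (simp_all add: arr_def Suc)
          then have "min (arr fs cs u 0) (arr fs cs n v) = cs ! v" by linarith
          then show ?thesis using u by (simp add: loops_def Suc)
        qed
      qed (simp add: loops_def len)
    qed
    show "\<forall>a\<in>balanced_arrays n. (\<lambda>(fs, cs). arr fs cs) (flows a, loops a) = a"
    proof (intro ballI ext, unfold prod.case)
      fix a i j assume a: "a \<in> balanced_arrays n"
      then have supp: "a k l = 0" if "\<not> (l \<le> k \<and> k \<le> n)" for k l
        using that unfolding balanced_arrays_def by blast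
      have *: "nat (net es (flows a) (Suc v)) + min (a v 0) (a n (Suc v)) = a v 0"
        "nat (- net es (flows a) (Suc v)) + min (a v 0) (a n (Suc v)) = a n (Suc v)" if "v < n" for v
        using net_flows[OF a that] by linarith+
      show "arr (flows a) (loops a) i j = a i j"
      proof (cases j)
        case 0
        then show ?thesis by (auto simp: arr_def loops_def * supp)
      next
        case (Suc v)
        consider "i < n" "j \<le> i" | "i < n" "\<not> j \<le> i" | "i = n" "j \<le> n" | "i = n" "\<not> j \<le> n" | "i > n"
          by linarith
        then show ?thesis
        proof cases
          case 1
          then have "(j, Suc i) \<in> pairs n" using Suc by (simp add: pairs_def)
          with 1 Suc show ?thesis by (simp add: arr_def flows_def ff_map)
        next
          case 2
          then have "(j, Suc i) \<notin> pairs n" by (simp add: pairs_def)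
          with 2 Suc show ?thesis by (simp add: arr_def ff_supp flows_def supp)
        next
          case 3
          then show ?thesis using Suc *[of v] by (simp add: arr_def loops_def)
        next
          case 4
          then show ?thesis using Suc by (simp add: arr_def supp)
        next
          case 5
          then show ?thesis using Suc by (simp add: arr_def supp)
        qed
      qed
    qed
    show "(\<lambda>(fs, cs). arr fs cs) ` ?fc \<subseteq> balanced_arrays n"
    proof safe
      fix fs cs :: "nat list" assume len: "length fs = length es" "length cs = Suc n"
      have "j \<le> i \<and> i \<le> n" if "arr fs cs i j \<noteq> 0" for i j
      proof -
        have "j \<le> i" if "ff fs (j, Suc i) \<noteq> 0"
          using that ff_supp[of "(j, Suc i)" fs] len by (cases "j \<le> i") (auto simp: pairs_def)
        then show ?thesis using that by (auto simp: arr_def split: if_splits)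
      qed
      moreover have "(\<Sum>j\<le>n. arr fs cs v j) = (\<Sum>i\<le>n. arr fs cs i (Suc v))" if v: "v < n" for v
      proof -
        have "(\<Sum>j=1..n. arr fs cs v j) = (\<Sum>j=1..n. ff fs (j, Suc v))"
          using v by (intro sum.cong) (auto simp: arr_def)
        moreover have "(\<Sum>j=1..n. arr fs cs (j - 1) (Suc v)) = (\<Sum>j=1..n. ff fs (Suc v, j))"
          using v by (intro sum.cong) (auto simp: arr_def)
        moreover have "arr fs cs v 0 = nat (net es fs (Suc v)) + cs ! Suc v"
          "arr fs cs n (Suc v) = nat (- net es fs (Suc v)) + cs ! Suc v"
          using v by (auto simp: arr_def)
        moreover have "net es fs (Suc v) = int (\<Sum>j=1..n. ff fs (Suc v, j)) - int (\<Sum>i=1..n. ff fs (i, Suc v))"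
          using v len by (intro net_arr) auto
        ultimately show ?thesis
          unfolding row[of "arr fs cs v"] col[of "\<lambda>i. arr fs cs i (Suc v)"] by linarith
      qed
      ultimately show "arr fs cs \<in> balanced_arrays n" by (auto simp: balanced_arrays_def)
    qed
  qed (auto simp: flows_def loops_def)
  have val: "array_value n ((\<lambda>(fs, cs). arr fs cs) x) = flow_size n es (fst x) + sum_list (snd x)"
    if "x \<in> ?fc" for x
  proof -
    obtain fs cs where x: "x = (fs, cs)" by (cases x)
    have len: "length cs = Suc n" using that by (simp add: x)
    have "sum_list cs = (\<Sum>j\<le>n. cs ! j)"
      by (simp add: sum_list_sum_nth len atLeast0LessThan lessThan_Suc_atMost del: sum.lessThan_Suc)
    also have "\<dots> = cs ! 0 + (\<Sum>j=1..n. cs ! j)" by (rule row)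
    finally have "sum_list cs = cs ! 0 + (\<Sum>j=1..n. cs ! j)" .
    moreover have "array_value n (arr fs cs) = (\<Sum>j=1..n. arr fs cs (j - 1) 0) + arr fs cs n 0"
      unfolding array_value_def by (rule col)
    moreover have "(\<Sum>j=1..n. arr fs cs (j - 1) 0) = (\<Sum>j=1..n. nat (net es fs j) + cs ! j)"
      by (intro sum.cong) (auto simp: arr_def)
    moreover have "arr fs cs n 0 = cs ! 0" by (simp add: arr_def)
    ultimately show ?thesis by (simp add: x flow_size_def sum.distrib)
  qed
  have "gf ?fc (\<lambda>x. flow_size n es (fst x) + sum_list (snd x)) = gf (balanced_arrays n) (array_value n)"
    by (rule gf_bij_betw[OF bij]) (rule val)
  then show ?thesis
    using gf_Times[OF wfin_flow_size[of es n] wfin_lists] es(1) by (simp add: flow_gf_def)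
qed

theorem theorem5p12:
  fixes n :: nat and P :: xpoly and Q :: "int poly"
  assumes "n \<ge> 2"
    and "reduced_polynomial_of (w0 n) P"
    and "Q = eval_xpoly (\<lambda>_. 1) P"
  shows "fps_of_poly (pcompose Q [:-1, 1:]) =
    Abs_fps (\<lambda>m. int (ehrhart (CRY (n + 1)) m)) * (1 - fps_X) ^ (((n + 1) choose 2) + 1)"
proof -
  obtain es where es: "set es = pairs n" "distinct es"
    using finite_distinct_list[OF finite_pairs] by blast
  let ?u = "1 - fps_X :: int fps"
  have exponent: "((n + 1) choose 2) + 1 = (n choose 2) + Suc n" by (simp add: numeral_2_eq_2)
  have "Abs_fps (\<lambda>m. int (ehrhart (CRY (n + 1)) m)) * ?u ^ (((n + 1) choose 2) + 1)
      = (?u ^ (n choose 2) * flow_gf n es) * (?u ^ Suc n * gf (lists_of_length (Suc n)) sum_list)"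
    unfolding ehrhart_series_CRY balanced_arrays_gf[OF es] exponent power_add by (simp only: mult_ac)
  also have "\<dots> = ?u ^ (n choose 2) * flow_gf n es" by (simp only: gf_lists mult_1_right)
  also have "\<dots> = fps_of_poly (pcompose Q [:-1, 1:])"
    using shift_fps_reduced_polynomial[OF es assms(2)] assms(3) by (simp add: shift_fps_def)
  finally show ?thesis by (rule sym)
qed

end
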